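(* Let $C\geq 1$, $\delta>0$ and $0<\theta<1$. Suppose that symmetric random vectors $X_1,\ldots,X_n$ with values in a real separable Banach space $E$ are independent and each satisfies $\mathrm{WB}(C,\delta,\theta)$. Then $X_1+\ldots+X_n$ satisfies $\mathrm{WB}(C',\delta,\theta')$, where $C'=12\cdot 9^{\delta}C$ and $\theta'=\min\{\theta/2,\,(96C\cdot 9^{\delta})^{-1}\}$.
   Context: A random vector $X$ is symmetric if $X$ and $-X$ have the same distribution. A symmetric random vector $X$ with values in a real separable Banach space $E$ satisfies $\mathrm{WB}(C,\delta,\theta)$ (the weak Borell inequality with constants $C\geq 1$, $\delta>0$, $0<\theta<1$) if for every continuous norm $\|\cdot\|$ on $E$ such that $\mathbb{P}(\|X\|>1)<\theta$, we have $$\mathbb{P}(\|X\|>\lambda)\leq C\lambda^{-\delta}\,\mathbb{P}(\|X\|>1)\qquad\text{for all }\lambda\geq 1.$$ *)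

theory Defs
  imports "HOL-Probability.Probability"
begin

definition is_norm :: "('e::real_vector \<Rightarrow> real) \<Rightarrow> bool" where
  "is_norm N \<longleftrightarrow>
     (\<forall>x. 0 \<le> N x) \<and> (\<forall>x. N x = 0 \<longleftrightarrow> x = 0) \<and>
     (\<forall>a x. N (a *\<^sub>R x) = \<bar>a\<bar> * N x) \<and>
     (\<forall>x y. N (x + y) \<le> N x + N y)"

text \<open>Separability of \<open>E\<close> is expressed by the class \<^class>\<open>second_countable_topology\<close>, which is
  equivalent to it for metric spaces. Random vectors are Borel measurable maps on a probability
  space.\<close>

definition symmetric_rv ::
    "'a measure \<Rightarrow> ('a \<Rightarrow> 'e::{banach, second_countable_topology}) \<Rightarrow> bool" where
  "symmetric_rv M X \<longleftrightarrow>
     X \<in> borel_measurable M \<and> distr M borel X = distr M borel (\<lambda>\<omega>. - X \<omega>)"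

text \<open>The weak Borell inequality. The quantified norm \<open>N\<close> is any norm that is continuous with
  respect to the topology of \<open>E\<close>; it need not be equivalent to the given norm. The admissible
  range of the constants and the symmetry of \<open>X\<close> are part of the property.\<close>

definition WB ::
    "'a measure \<Rightarrow> ('a \<Rightarrow> 'e::{banach, second_countable_topology}) \<Rightarrow> real \<Rightarrow> real \<Rightarrow> real \<Rightarrow> bool"
  where
  "WB M X C \<delta> \<theta> \<longleftrightarrow>
     1 \<le> C \<and> 0 < \<delta> \<and> 0 < \<theta> \<and> \<theta> < 1 \<and> symmetric_rv M X \<and>
     (\<forall>N. is_norm N \<and> continuous_on UNIV N \<and> \<P>(\<omega> in M. N (X \<omega>) > 1) < \<theta> \<longrightarrow>
        (\<forall>t\<ge>1. \<P>(\<omega> in M. N (X \<omega>) > t) \<le> C * t powr (-\<delta>) * \<P>(\<omega> in M. N (X \<omega>) > 1)))"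

end

theory Submission
  imports Defs
begin

text \<open>
  Write \<open>S\<close> for the sum, \<open>F t\<close> for the probability that \<open>N S > t\<close>, and \<open>p = F 1\<close>. Two facts drive
  the proof. First, a vector of independent symmetric coordinates keeps its law when some
  coordinates change sign. This yields Levy's maximal inequality: the event that one of the
  partial sums, or one of the summands, has norm above \<open>t\<close> has probability at most \<open>2 * F t\<close>
  (\<open>prob_some_partial_sum_le\<close>). Second, if \<open>N S > 3 * t\<close>, then either some summand has norm above
  \<open>t\<close>, or, when the partial sums first exceed \<open>t\<close>, the sum of the remaining terms has norm above
  \<open>t\<close> as well. The latter two events are independent and each is controlled by Levy's inequality,
  whence the bound \<open>4 * (F t)\<^sup>2\<close> in \<open>Hoffmann_Jorgensen\<close>.

  In particular each summand satisfies \<open>N (X i) > 1\<close> with probability at most \<open>2 * p < \<theta>\<close>, so the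
  weak Borell inequality is available for it. As the summands are independent and \<open>p\<close> is small,
  these probabilities even add up to at most \<open>4 * p\<close> (\<open>sum_prob_summand_le\<close>), which removes the
  number of summands from the estimate. For \<open>t \<ge> 1\<close> this gives
  \<open>F (3 * t) \<le> 4 * C * t powr (-\<delta>) * p + 4 * (F t)\<^sup>2\<close>. Along the powers of three the square is
  harmless: the hypothesis \<open>p < 1 / (96 * C * 9 powr \<delta>)\<close> keeps it below the linear term, and
  \<open>tripling_recursion_decay\<close> obtains the decay \<open>t powr (-\<delta>)\<close> with the constant
  \<open>8 * C * 9 powr \<delta>\<close>, slightly better than the one claimed. Symmetry of \<open>S\<close> is the case in which
  all the signs change.
\<close>

section \<open>Sign changes of independent symmetric vectors\<close>

locale independent_symmetric = prob_space M for M :: "'a measure" +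
  fixes X :: "'i \<Rightarrow> 'a \<Rightarrow> 'e::{banach, second_countable_topology}" and I :: "'i set"
  assumes finite_I: "finite I"
    and indep: "indep_vars (\<lambda>_. borel) X I"
    and symmetric: "\<And>i. i \<in> I \<Longrightarrow> symmetric_rv M (X i)"
begin

lemma X_measurable [measurable]: "i \<in> I \<Longrightarrow> X i \<in> borel_measurable M"
  using symmetric by (auto simp: symmetric_rv_def)

lemma sum_X_measurable: "J \<subseteq> I \<Longrightarrow> (\<lambda>\<omega>. \<Sum>i\<in>J. X i \<omega>) \<in> borel_measurable M"
  by (intro borel_measurable_sum X_measurable) auto

definition flip :: "'i set \<Rightarrow> ('i \<Rightarrow> 'e) \<Rightarrow> 'i \<Rightarrow> 'e" where
  "flip J f i = (if i \<in> J then f i else - f i)"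

text \<open>By independence the joint law is the product of the marginal laws, and symmetry makes each
  marginal insensitive to a change of sign.\<close>

lemma distr_flip:
  "distr M (\<Pi>\<^sub>M i\<in>I. borel) (\<lambda>\<omega>. \<lambda>i\<in>I. flip J (\<lambda>i. X i \<omega>) i)
   = distr M (\<Pi>\<^sub>M i\<in>I. borel) (\<lambda>\<omega>. \<lambda>i\<in>I. X i \<omega>)"
proof (cases "I = {}")
  case True
  then show ?thesis by (simp add: restrict_def)
next
  case False
  let ?Y = "\<lambda>i \<omega>. flip J (\<lambda>i. X i \<omega>) i"
  have Y_meas: "?Y i \<in> borel_measurable M" if "i \<in> I" for i
    using X_measurable[OF that] by (simp add: flip_def)
  have "indep_vars (\<lambda>_. borel) (\<lambda>i \<omega>. (\<lambda>x. if i \<in> J then x else - x) (X i \<omega>)) I"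
    by (rule indep_vars_compose2[OF indep]) simp
  then have indep_Y: "indep_vars (\<lambda>_. borel) ?Y I"
    by (simp add: flip_def)
  have distr_Y: "distr M borel (?Y i) = distr M borel (X i)" if "i \<in> I" for i
    using symmetric[OF that] by (cases "i \<in> J") (simp_all add: flip_def symmetric_rv_def)
  have "distr M (\<Pi>\<^sub>M i\<in>I. borel) (\<lambda>\<omega>. \<lambda>i\<in>I. ?Y i \<omega>) = (\<Pi>\<^sub>M i\<in>I. distr M borel (?Y i))"
    using indep_vars_iff_distr_eq_PiM'[OF False, where M' = "\<lambda>_. borel" and X = ?Y] Y_meas indep_Y by blast
  also have "\<dots> = (\<Pi>\<^sub>M i\<in>I. distr M borel (X i))"
    by (rule PiM_cong) (simp_all add: distr_Y)
  also have "\<dots> = distr M (\<Pi>\<^sub>M i\<in>I. borel) (\<lambda>\<omega>. \<lambda>i\<in>I. X i \<omega>)"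
    using indep_vars_iff_distr_eq_PiM'[OF False, where M' = "\<lambda>_. borel" and X = X] X_measurable indep by simp
  finally show ?thesis .
qed

text \<open>The form of sign invariance used below. The predicate \<open>P\<close> may inspect only the coordinates in
  \<open>I\<close>, because the product measure lives on functions that are undefined outside \<open>I\<close>.\<close>

lemma prob_flip:
  assumes [measurable]: "Measurable.pred (\<Pi>\<^sub>M i\<in>I. borel) P"
    and local: "\<And>f. P (restrict f I) = P f"
  shows "prob {\<omega> \<in> space M. P (flip J (\<lambda>i. X i \<omega>))} = prob {\<omega> \<in> space M. P (\<lambda>i. X i \<omega>)}"
proof -
  let ?A = "{f \<in> space (\<Pi>\<^sub>M i\<in>I. borel). P f}"
  have A: "?A \<in> sets (\<Pi>\<^sub>M i\<in>I. borel)" by measurable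
  have law: "measure (distr M (\<Pi>\<^sub>M i\<in>I. borel) (\<lambda>\<omega>. \<lambda>i\<in>I. Y \<omega> i)) ?A
      = prob {\<omega> \<in> space M. P (Y \<omega>)}"
    if "\<And>i. i \<in> I \<Longrightarrow> (\<lambda>\<omega>. Y \<omega> i) \<in> borel_measurable M" for Y :: "'a \<Rightarrow> 'i \<Rightarrow> 'e"
  proof -
    have "(\<lambda>\<omega>. \<lambda>i\<in>I. Y \<omega> i) -` ?A \<inter> space M = {\<omega> \<in> space M. P (Y \<omega>)}"
      using local by (auto simp: space_PiM)
    then show ?thesis
      using that by (subst measure_distr[OF _ A]) (auto intro!: measurable_restrict)
  qed
  have "(\<lambda>\<omega>. flip J (\<lambda>i. X i \<omega>) i) \<in> borel_measurable M" if "i \<in> I" for i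
    using X_measurable[OF that] by (simp add: flip_def)
  then show ?thesis
    using law[of "\<lambda>\<omega>. flip J (\<lambda>i. X i \<omega>)"] law[of "\<lambda>\<omega> i. X i \<omega>"] X_measurable
    by (simp add: distr_flip)
qed

lemma symmetric_sum: "symmetric_rv M (\<lambda>\<omega>. \<Sum>i\<in>I. X i \<omega>)"
  unfolding symmetric_rv_def
proof
  show S[measurable]: "(\<lambda>\<omega>. \<Sum>i\<in>I. X i \<omega>) \<in> borel_measurable M"
    by (rule sum_X_measurable) simp
  show "distr M borel (\<lambda>\<omega>. \<Sum>i\<in>I. X i \<omega>) = distr M borel (\<lambda>\<omega>. - (\<Sum>i\<in>I. X i \<omega>))"
  proof (rule measure_eqI)
    fix B assume "B \<in> sets (distr M borel (\<lambda>\<omega>. \<Sum>i\<in>I. X i \<omega>))"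
    then have B[measurable]: "B \<in> sets borel" by simp
    have "Measurable.pred (\<Pi>\<^sub>M i\<in>I. borel) (\<lambda>f. (\<Sum>i\<in>I. f i) \<in> B)"
      by measurable
    from prob_flip[OF this, of "{}"]
    have "prob {\<omega> \<in> space M. - (\<Sum>i\<in>I. X i \<omega>) \<in> B} = prob {\<omega> \<in> space M. (\<Sum>i\<in>I. X i \<omega>) \<in> B}"
      by (simp add: flip_def sum_negf)
    then show "emeasure (distr M borel (\<lambda>\<omega>. \<Sum>i\<in>I. X i \<omega>)) B
        = emeasure (distr M borel (\<lambda>\<omega>. - (\<Sum>i\<in>I. X i \<omega>))) B"
      by (simp add: emeasure_distr emeasure_eq_measure vimage_def Int_def conj_commute)
  qed simp
qed

end

section \<open>Maximal inequalities in a continuous norm\<close>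

locale normed_independent_symmetric = independent_symmetric M X I
  for M :: "'a measure" and X :: "'i \<Rightarrow> 'a \<Rightarrow> 'e::{banach, second_countable_topology}" and I +
  fixes N :: "'e \<Rightarrow> real"
  assumes norm_N: "is_norm N" and cont_N: "continuous_on UNIV N"
begin

lemma N_measurable [measurable]: "N \<in> borel_measurable borel"
  using cont_N by (rule borel_measurable_continuous_onI)

lemma N_0: "N 0 = 0"
  and N_triangle: "N (x + y) \<le> N x + N y"
  and N_scaleR: "N (a *\<^sub>R x) = \<bar>a\<bar> * N x"
  using norm_N by (auto simp: is_norm_def)

abbreviation tail :: "'i set \<Rightarrow> real \<Rightarrow> 'a set" where
  "tail J t \<equiv> {\<omega> \<in> space M. N (\<Sum>i\<in>J. X i \<omega>) > t}"

lemma tail_sets [measurable]: "J \<subseteq> I \<Longrightarrow> tail J t \<in> sets M"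
  using sum_X_measurable[of J] by measurable

text \<open>A predicate on coordinate functions rather than an event, so that it can be evaluated both at
  the vector \<open>X\<close> and at its reflection.\<close>

definition first_passage :: "(nat \<Rightarrow> 'i set) \<Rightarrow> real \<Rightarrow> nat \<Rightarrow> ('i \<Rightarrow> 'e) \<Rightarrow> bool" where
  "first_passage J t k f \<longleftrightarrow> N (\<Sum>i\<in>J k. f i) > t \<and> (\<forall>j<k. N (\<Sum>i\<in>J j. f i) \<le> t)"

abbreviation passage :: "(nat \<Rightarrow> 'i set) \<Rightarrow> real \<Rightarrow> nat \<Rightarrow> 'a set" where
  "passage J t k \<equiv> {\<omega> \<in> space M. first_passage J t k (\<lambda>i. X i \<omega>)}"

lemma norm_sum_measurable:
  assumes "K \<subseteq> L"
  shows "(\<lambda>f. N (\<Sum>i\<in>K. f i)) \<in> borel_measurable (\<Pi>\<^sub>M i\<in>L. (borel :: 'e measure))"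
proof -
  have "(\<lambda>f. \<Sum>i\<in>K. f i) \<in> borel_measurable (\<Pi>\<^sub>M i\<in>L. (borel :: 'e measure))"
    using assms by (intro borel_measurable_sum measurable_component_singleton) auto
  then show ?thesis by measurable
qed

lemma first_passage_measurable:
  assumes "\<And>j. j \<le> k \<Longrightarrow> J j \<subseteq> L"
  shows "Measurable.pred (\<Pi>\<^sub>M i\<in>L. (borel :: 'e measure)) (first_passage J t k)"
proof -
  have [measurable]: "(\<lambda>f. N (\<Sum>i\<in>J j. f i)) \<in> borel_measurable (\<Pi>\<^sub>M i\<in>L. (borel :: 'e measure))"
    if "j \<in> {..k}" for j
    using that by (intro norm_sum_measurable assms) auto
  have "Measurable.pred (\<Pi>\<^sub>M i\<in>L. (borel :: 'e measure))
      (\<lambda>f. N (\<Sum>i\<in>J k. f i) > t \<and> (\<forall>j\<in>{..<k}. N (\<Sum>i\<in>J j. f i) \<le> t))"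
    by measurable
  then show ?thesis
    unfolding first_passage_def by (simp add: Ball_def)
qed

lemma first_passage_restrict:
  assumes "\<And>j. j \<le> k \<Longrightarrow> J j \<subseteq> L"
  shows "first_passage J t k (restrict f L) = first_passage J t k f"
proof -
  have "(\<Sum>i\<in>J j. restrict f L i) = (\<Sum>i\<in>J j. f i)" if "j \<le> k" for j
    using assms[OF that] by (intro sum.cong) auto
  then show ?thesis by (simp add: first_passage_def)
qed

lemma passage_sets [measurable]:
  assumes "\<And>j. j \<le> k \<Longrightarrow> J j \<subseteq> I"
  shows "passage J t k \<in> sets M"
proof -
  have [measurable]: "(\<lambda>\<omega>. \<lambda>i\<in>I. X i \<omega>) \<in> measurable M (\<Pi>\<^sub>M i\<in>I. borel)"
    by (intro measurable_restrict X_measurable)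
  have [measurable]: "Measurable.pred (\<Pi>\<^sub>M i\<in>I. (borel :: 'e measure)) (first_passage J t k)"
    using assms by (rule first_passage_measurable)
  have "{\<omega> \<in> space M. first_passage J t k (\<lambda>i\<in>I. X i \<omega>)} \<in> sets M"
    by measurable
  then show ?thesis
    using first_passage_restrict[of k J I] assms by simp
qed

lemma passage_disjoint: "disjoint_family (passage J t)"
proof -
  have once: "\<not> first_passage J t k f" if "j < k" "first_passage J t j f" for j k f
    using that by (auto simp: first_passage_def)
  show ?thesis
    unfolding disjoint_family_on_def
  proof (intro ballI impI)
    fix j k :: nat assume "j \<noteq> k"
    then consider "j < k" | "k < j" by linarith
    then show "passage J t j \<inter> passage J t k = {}"
      by cases (auto dest: once)
  qed
qed

lemma exists_passage:
  assumes "\<omega> \<in> space M" "N (\<Sum>i\<in>J k. X i \<omega>) > t"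
  obtains l where "l \<le> k" "\<omega> \<in> passage J t l"
proof -
  define P where "P k \<longleftrightarrow> N (\<Sum>i\<in>J k. X i \<omega>) > t" for k
  define l where "l = (LEAST k. P k)"
  have "P k" using assms(2) by (simp add: P_def)
  then have "P l" "l \<le> k" unfolding l_def by (rule LeastI, rule Least_le)
  moreover have "\<not> P j" if "j < l" for j
    using that unfolding l_def by (rule not_less_Least)
  ultimately have "\<omega> \<in> passage J t l"
    using assms(1) by (simp add: first_passage_def P_def not_less)
  with \<open>l \<le> k\<close> show ?thesis by (rule that)
qed

text \<open>The sum over \<open>J\<close> is the midpoint of the full sum and its reflection, so it cannot be larger
  in norm than both.\<close>

lemma norm_flip_reaches:
  assumes "J \<subseteq> I" "N (\<Sum>i\<in>J. f i) > t"
  shows "N (\<Sum>i\<in>I. f i) > t \<or> N (\<Sum>i\<in>I. flip J f i) > t"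
proof -
  have "(\<Sum>i\<in>I. f i) + (\<Sum>i\<in>I. flip J f i) = (\<Sum>i\<in>I. if i \<in> J then 2 *\<^sub>R f i else 0)"
    unfolding sum.distrib[symmetric] by (rule sum.cong) (auto simp: flip_def scaleR_2)
  also have "\<dots> = 2 *\<^sub>R (\<Sum>i\<in>J. f i)"
    using assms(1) finite_I by (simp add: sum.If_cases Int_absorb1 scaleR_sum_right)
  finally have "2 * N (\<Sum>i\<in>J. f i) \<le> N (\<Sum>i\<in>I. f i) + N (\<Sum>i\<in>I. flip J f i)"
    using N_triangle[of "\<Sum>i\<in>I. f i" "\<Sum>i\<in>I. flip J f i"] by (simp add: N_scaleR)
  with assms(2) show ?thesis by linarith
qed

text \<open>Reflection about \<open>J k\<close> leaves the earlier sums alone when their index sets lie in \<open>J k\<close>, and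
  negates them when the index sets are disjoint from \<open>J k\<close>; the norm notices neither.\<close>

lemma first_passage_flip:
  assumes "\<And>j. j < k \<Longrightarrow> J j \<subseteq> J k \<or> J j \<inter> J k = {}"
  shows "first_passage J t k (flip (J k) f) = first_passage J t k f"
proof -
  have "N (\<Sum>i\<in>J j. flip (J k) f i) = N (\<Sum>i\<in>J j. f i)" if "j \<le> k" for j
  proof (cases "J j \<subseteq> J k")
    case True
    then have "(\<Sum>i\<in>J j. flip (J k) f i) = (\<Sum>i\<in>J j. f i)"
      by (intro sum.cong) (auto simp: flip_def)
    then show ?thesis by simp
  next
    case False
    with assms[of j] that have "J j \<inter> J k = {}"
      by (cases "j = k") auto
    then have "(\<Sum>i\<in>J j. flip (J k) f i) = (\<Sum>i\<in>J j. - f i)"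
      by (intro sum.cong) (auto simp: flip_def)
    then show ?thesis
      using N_scaleR[of "-1" "\<Sum>i\<in>J j. f i"] by (simp add: sum_negf)
  qed
  then show ?thesis by (simp add: first_passage_def)
qed

text \<open>Levy's inequality, refined to first passages. On the event of first passage at \<open>k\<close>, the full
  sum or its reflection about \<open>J k\<close> exceeds \<open>t\<close>; both have the same probability jointly with that
  event, so conditionally on it the full sum exceeds \<open>t\<close> with probability at least one half. The
  condition on the family \<open>J\<close> covers at once the initial segments (partial sums), the singletons
  (largest summand) and a single index set.\<close>

lemma sum_prob_passage_le:
  assumes J: "\<And>k. k < m \<Longrightarrow> J k \<subseteq> I"
    and laminar: "\<And>j k. j < k \<Longrightarrow> k < m \<Longrightarrow> J j \<subseteq> J k \<or> J j \<inter> J k = {}"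
  shows "(\<Sum>k<m. prob (passage J t k)) \<le> 2 * prob (tail I t)"
proof -
  let ?E = "passage J t" and ?G = "tail I t"
  have E: "?E k \<in> events" if "k < m" for k
    using that by (intro passage_sets J) auto
  have G: "?G \<in> events" by (rule tail_sets) simp
  have half: "prob (?E k) \<le> 2 * prob (?E k \<inter> ?G)" if k: "k < m" for k
  proof -
    define P where "P f \<longleftrightarrow> first_passage J t k f \<and> N (\<Sum>i\<in>I. f i) > t" for f
    have sub: "\<And>j. j \<le> k \<Longrightarrow> J j \<subseteq> I" using k by (intro J) auto
    have lam: "\<And>j. j < k \<Longrightarrow> J j \<subseteq> J k \<or> J j \<inter> J k = {}" using k by (intro laminar) auto
    note [measurable] = norm_sum_measurable[OF order_refl, of I] first_passage_measurable[OF sub]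
    have P: "Measurable.pred (\<Pi>\<^sub>M i\<in>I. borel) P"
      unfolding P_def by measurable
    have P_local: "P (restrict f I) = P f" for f
      using first_passage_restrict[OF sub] by (simp add: P_def)
    let ?E' = "{\<omega> \<in> space M. P (flip (J k) (\<lambda>i. X i \<omega>))}"
    have EG: "?E k \<inter> ?G = {\<omega> \<in> space M. P (\<lambda>i. X i \<omega>)}"
      by (auto simp: P_def)
    have eq: "prob ?E' = prob (?E k \<inter> ?G)"
      unfolding EG by (rule prob_flip[OF P P_local])
    have "?E' \<in> events"
    proof -
      have [measurable]: "(\<lambda>\<omega>. \<lambda>i\<in>I. flip (J k) (\<lambda>i. X i \<omega>) i) \<in> measurable M (\<Pi>\<^sub>M i\<in>I. borel)"
        using X_measurable by (intro measurable_restrict) (simp add: flip_def)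
      note P[measurable]
      have "{\<omega> \<in> space M. P (\<lambda>i\<in>I. flip (J k) (\<lambda>i. X i \<omega>) i)} \<in> events"
        by measurable
      then show ?thesis using P_local by simp
    qed
    moreover have "?E k \<subseteq> (?E k \<inter> ?G) \<union> ?E'"
      using norm_flip_reaches[OF J[OF k]] first_passage_flip[of k J t, OF lam]
      by (auto simp: P_def first_passage_def[of J t k])
    moreover have "?E k \<inter> ?G \<in> events" using E[OF k] G by auto
    ultimately have "prob (?E k) \<le> prob (?E k \<inter> ?G) + prob ?E'"
      by (meson finite_measure_mono measure_Un_le order_trans sets.Un)
    then show ?thesis by (simp add: eq)
  qed
  have "(\<Sum>k<m. prob (?E k)) \<le> 2 * (\<Sum>k<m. prob (?E k \<inter> ?G))"
    unfolding sum_distrib_left using half by (intro sum_mono) auto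
  also have "(\<Sum>k<m. prob (?E k \<inter> ?G)) = prob (\<Union>k<m. ?E k \<inter> ?G)"
    using E G passage_disjoint[of J t]
    by (intro finite_measure_finite_Union[symmetric])
       (auto simp: disjoint_family_on_def)
  also have "\<dots> \<le> prob ?G"
    using G by (intro finite_measure_mono) auto
  finally show ?thesis by simp
qed

lemma prob_some_partial_sum_le:
  fixes J :: "nat \<Rightarrow> 'i set"
  assumes J: "\<And>k. k < m \<Longrightarrow> J k \<subseteq> I"
    and laminar: "\<And>j k. j < k \<Longrightarrow> k < m \<Longrightarrow> J j \<subseteq> J k \<or> J j \<inter> J k = {}"
  shows "prob (\<Union>k<m. tail (J k) t) \<le> 2 * prob (tail I t)"
proof -
  have E: "passage J t k \<in> events" if "k < m" for k
    using that by (intro passage_sets J) auto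
  have "(\<Union>k<m. tail (J k) t) \<subseteq> (\<Union>k<m. passage J t k)"
  proof
    fix \<omega> assume "\<omega> \<in> (\<Union>k<m. tail (J k) t)"
    then obtain k where k: "k < m" "\<omega> \<in> space M" "N (\<Sum>i\<in>J k. X i \<omega>) > t" by auto
    then obtain l where "l \<le> k" "\<omega> \<in> passage J t l" by (rule_tac exists_passage)
    then show "\<omega> \<in> (\<Union>k<m. passage J t k)" using k(1) by auto
  qed
  then have "prob (\<Union>k<m. tail (J k) t) \<le> prob (\<Union>k<m. passage J t k)"
    using E by (intro finite_measure_mono) auto
  also have "\<dots> \<le> (\<Sum>k<m. prob (passage J t k))"
    using E by (intro finite_measure_subadditive_finite) auto
  also have "\<dots> \<le> 2 * prob (tail I t)"
    by (rule sum_prob_passage_le[OF J laminar])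
  finally show ?thesis .
qed

lemma prob_partial_sum_le:
  assumes "K \<subseteq> I"
  shows "prob (tail K t) \<le> 2 * prob (tail I t)"
  using prob_some_partial_sum_le[of "Suc 0" "\<lambda>_. K" t] assms by (simp add: lessThan_Suc)

lemma prob_some_summand_le:
  "prob (\<Union>i\<in>I. tail {i} t) \<le> 2 * prob (tail I t)"
proof -
  obtain e where e: "bij_betw e {..<card I} I"
    using ex_bij_betw_nat_finite[OF finite_I] by (auto simp: atLeast0LessThan)
  have "(\<Union>i\<in>e ` {..<card I}. tail {i} t) = (\<Union>k<card I. tail {e k} t)"
    by (simp only: image_image)
  then have "(\<Union>i\<in>I. tail {i} t) = (\<Union>k<card I. tail {e k} t)"
    by (simp only: bij_betw_imp_surj_on[OF e])
  also have "prob \<dots> \<le> 2 * prob (tail I t)"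
  proof (rule prob_some_partial_sum_le)
    show "{e k} \<subseteq> I" if "k < card I" for k
      using that bij_betwE[OF e] by auto
    show "{e j} \<subseteq> {e k} \<or> {e j} \<inter> {e k} = {}" for j k by auto
  qed
  finally show ?thesis .
qed

text \<open>A converse to the union bound: independence turns the probability that no summand is large
  into a product, which is at most \<open>exp (- s)\<close> for the sum \<open>s\<close> of the individual probabilities.
  Levy's inequality bounds that product below by \<open>1 - 2 * q\<close>, where \<open>q\<close> is the tail probability of
  the full sum. For \<open>q \<le> 1 / 4\<close> this forces \<open>s \<le> 4 * q\<close>.\<close>

lemma sum_prob_summand_le:
  assumes small: "prob (tail I t) \<le> 1 / 4"
  shows "(\<Sum>i\<in>I. prob (tail {i} t)) \<le> 4 * prob (tail I t)"
proof (cases "I = {}")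
  case False
  let ?p = "\<lambda>i. prob (tail {i} t)" and ?q = "prob (tail I t)"
  define s where "s = (\<Sum>i\<in>I. ?p i)"
  have s0: "0 \<le> s" unfolding s_def by (simp add: sum_nonneg)
  have ev: "tail {i} t \<in> events" if "i \<in> I" for i using that by (intro tail_sets) auto
  have B: "{x. N x \<le> t} \<in> sets (borel :: 'e measure)" by measurable
  have pr: "prob (X i -` {x. N x \<le> t} \<inter> space M) = 1 - ?p i" if "i \<in> I" for i
  proof -
    have "X i -` {x. N x \<le> t} \<inter> space M = space M - tail {i} t" by auto
    then show ?thesis using prob_compl[OF ev[OF that]] by simp
  qed
  have "1 - 2 * ?q \<le> 1 - prob (\<Union>i\<in>I. tail {i} t)"
    using prob_some_summand_le[of t] by simp
  also have "\<dots> = prob (space M - (\<Union>i\<in>I. tail {i} t))"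
    using ev finite_I by (intro prob_compl[symmetric]) auto
  also have "space M - (\<Union>i\<in>I. tail {i} t) = (\<Inter>i\<in>I. X i -` {x. N x \<le> t} \<inter> space M)"
    using False by (auto simp: not_less[symmetric])
  also have "prob \<dots> = (\<Prod>i\<in>I. prob (X i -` {x. N x \<le> t} \<inter> space M))"
    by (rule indep_varsD_finite[OF indep False finite_I B])
  also have "\<dots> = (\<Prod>i\<in>I. 1 - ?p i)" by (rule prod.cong[OF refl]) (rule pr)
  also have "\<dots> \<le> (\<Prod>i\<in>I. exp (- ?p i))"
  proof (rule prod_mono)
    show "0 \<le> 1 - ?p i \<and> 1 - ?p i \<le> exp (- ?p i)" for i
      using exp_ge_add_one_self[of "- ?p i"] by simp
  qed
  also have "\<dots> = exp (- s)"
    by (simp only: s_def sum_negf[symmetric] exp_sum[OF finite_I])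
  finally have "(1 - 2 * ?q) * exp s \<le> 1"
    by (simp add: exp_minus field_simps)
  moreover have "(1 - 2 * ?q) * (1 + s) \<le> (1 - 2 * ?q) * exp s"
    using small exp_ge_add_one_self[of s] by (intro mult_left_mono) auto
  ultimately have "s \<le> 2 * ?q + 2 * ?q * s"
    by (simp add: algebra_simps)
  also have "2 * ?q * s \<le> (1 / 2) * s"
    using small s0 by (intro mult_right_mono) auto
  finally show ?thesis unfolding s_def[symmetric] by simp
qed simp

end

section \<open>The Hoffmann-Jorgensen inequality\<close>

text \<open>Let the partial sums first exceed \<open>t\<close> in norm at time \<open>k\<close>. The sum up to \<open>k - 1\<close> contributes
  at most \<open>t\<close>, and the \<open>k\<close>-th summand at most \<open>t\<close> unless it is counted separately, so a total above
  \<open>3 * t\<close> leaves more than \<open>t\<close> for the sum after \<open>k\<close>. This remainder is independent of what happened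
  up to time \<open>k\<close>; summing over \<open>k\<close>, Levy's inequality gives one factor \<open>2 * q\<close> for the passage and
  one for the remainder, \<open>q\<close> being the probability that the full sum exceeds \<open>t\<close>.\<close>

lemma Hoffmann_Jorgensen:
  fixes X :: "nat \<Rightarrow> 'a \<Rightarrow> 'e::{banach, second_countable_topology}"
  assumes "normed_independent_symmetric M X {1..n} N" and t: "0 \<le> t"
  shows "\<P>(\<omega> in M. N (\<Sum>i=1..n. X i \<omega>) > 3 * t)
    \<le> (\<Sum>i=1..n. \<P>(\<omega> in M. N (X i \<omega>) > t)) + 4 * (\<P>(\<omega> in M. N (\<Sum>i=1..n. X i \<omega>) > t))\<^sup>2"
proof -
  interpret normed_independent_symmetric M X "{1..n}" N by fact
  \<comment> \<open>Starting from the empty sum ensures that a first passage has a predecessor below the level.\<close>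
  let ?J = "\<lambda>k. {1..k}" and ?R = "\<lambda>k. {k<..n}" and ?q = "prob (tail {1..n} t)"
  let ?E = "\<lambda>k. passage ?J t k" and ?T = "\<lambda>k. tail (?R k) t"
  have E: "?E k \<in> events" if "k < Suc n" for k
    using that by (intro passage_sets) auto
  have T: "?T k \<in> events" for k
    by (intro tail_sets) auto
  have D: "tail {i} t \<in> events" if "i \<in> {1..n}" for i
    using that by (intro tail_sets) auto
  have cover: "tail {1..n} (3 * t) \<subseteq> (\<Union>i\<in>{1..n}. tail {i} t) \<union> (\<Union>k<Suc n. ?E k \<inter> ?T k)"
  proof
    fix \<omega> assume "\<omega> \<in> tail {1..n} (3 * t)"
    then have w: "\<omega> \<in> space M" and big: "N (\<Sum>i=1..n. X i \<omega>) > 3 * t" by auto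
    have "N (\<Sum>i\<in>?J n. X i \<omega>) > t" using big t by linarith
    with w obtain k where k: "k \<le> n" "\<omega> \<in> ?E k" by (rule exists_passage)
    then have "N (\<Sum>i\<in>?J k. X i \<omega>) > t" by (simp add: first_passage_def)
    with t obtain j where j: "k = Suc j" by (cases k) (auto simp: N_0)
    have prev: "N (\<Sum>i\<in>?J j. X i \<omega>) \<le> t" using k(2) j by (simp add: first_passage_def)
    show "\<omega> \<in> (\<Union>i\<in>{1..n}. tail {i} t) \<union> (\<Union>k<Suc n. ?E k \<inter> ?T k)"
    proof (cases "N (X k \<omega>) > t")
      case True
      then have "\<omega> \<in> tail {k} t" using w by simp
      then show ?thesis using k(1) j by auto
    next
      case False
      have "{1..n} = {1..j} \<union> ({k} \<union> ?R k)" using k(1) j by auto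
      then have "(\<Sum>i=1..n. X i \<omega>) = (\<Sum>i\<in>?J j. X i \<omega>) + (X k \<omega> + (\<Sum>i\<in>?R k. X i \<omega>))"
        using j by (simp only:) (subst sum.union_disjoint; auto)+
      then have "N (\<Sum>i=1..n. X i \<omega>) \<le> N (\<Sum>i\<in>?J j. X i \<omega>) + (N (X k \<omega>) + N (\<Sum>i\<in>?R k. X i \<omega>))"
        using N_triangle[of "\<Sum>i\<in>?J j. X i \<omega>" "X k \<omega> + (\<Sum>i\<in>?R k. X i \<omega>)"]
          N_triangle[of "X k \<omega>" "\<Sum>i\<in>?R k. X i \<omega>"] by simp
      then have "N (\<Sum>i\<in>?R k. X i \<omega>) > t" using prev big False by linarith
      then show ?thesis using k w by auto
    qed
  qed
  have indep_ET: "prob (?E k \<inter> ?T k) = prob (?E k) * prob (?T k)" if k: "k < Suc n" for k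
  proof -
    let ?A = "{f \<in> space (\<Pi>\<^sub>M i\<in>{1..k}. (borel :: 'e measure)). first_passage ?J t k f}"
    let ?B = "{f \<in> space (\<Pi>\<^sub>M i\<in>?R k. (borel :: 'e measure)). N (\<Sum>i\<in>?R k. f i) > t}"
    have sub: "\<And>j. j \<le> k \<Longrightarrow> ?J j \<subseteq> {1..k}" by auto
    note [measurable] = norm_sum_measurable[OF order_refl, of "?R k"] first_passage_measurable[OF sub]
    have A: "?A \<in> sets (\<Pi>\<^sub>M i\<in>{1..k}. borel)" and B: "?B \<in> sets (\<Pi>\<^sub>M i\<in>?R k. borel)"
      by measurable
    let ?Y = "\<lambda>\<omega>. \<lambda>i\<in>{1..k}. X i \<omega>" and ?Z = "\<lambda>\<omega>. \<lambda>i\<in>?R k. X i \<omega>"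
    have "indep_var (\<Pi>\<^sub>M i\<in>{1..k}. borel) ?Y (\<Pi>\<^sub>M i\<in>?R k. borel) ?Z"
      using k by (intro indep_var_restrict[OF indep]) auto
    from indep_varD[OF this A B]
    have "prob ((\<lambda>\<omega>. (?Y \<omega>, ?Z \<omega>)) -` (?A \<times> ?B) \<inter> space M)
        = prob (?Y -` ?A \<inter> space M) * prob (?Z -` ?B \<inter> space M)" .
    moreover have "?Y -` ?A \<inter> space M = ?E k" "?Z -` ?B \<inter> space M = ?T k"
      using first_passage_restrict[OF sub] by (auto simp: space_PiM)
    moreover have "(\<lambda>\<omega>. (?Y \<omega>, ?Z \<omega>)) -` (?A \<times> ?B) \<inter> space M
        = (?Y -` ?A \<inter> space M) \<inter> (?Z -` ?B \<inter> space M)" by auto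
    ultimately show ?thesis by simp
  qed
  have "(\<Sum>k<Suc n. prob (?E k \<inter> ?T k)) \<le> (\<Sum>k<Suc n. prob (?E k) * (2 * ?q))"
  proof (intro sum_mono)
    fix k assume "k \<in> {..<Suc n}"
    then have "prob (?E k \<inter> ?T k) = prob (?E k) * prob (?T k)" by (intro indep_ET) simp
    also have "\<dots> \<le> prob (?E k) * (2 * ?q)"
      by (intro mult_left_mono prob_partial_sum_le) auto
    finally show "prob (?E k \<inter> ?T k) \<le> prob (?E k) * (2 * ?q)" .
  qed
  also have "\<dots> = (\<Sum>k<Suc n. prob (?E k)) * (2 * ?q)"
    by (rule sum_distrib_right[symmetric])
  also have "\<dots> \<le> (2 * ?q) * (2 * ?q)"
    by (intro mult_right_mono sum_prob_passage_le) auto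
  finally have stopped: "(\<Sum>k<Suc n. prob (?E k \<inter> ?T k)) \<le> 4 * ?q\<^sup>2"
    by (simp add: power2_eq_square)
  have "prob (tail {1..n} (3 * t))
      \<le> prob ((\<Union>i\<in>{1..n}. tail {i} t) \<union> (\<Union>k<Suc n. ?E k \<inter> ?T k))"
    using E T D by (intro finite_measure_mono[OF cover]) auto
  also have "\<dots> \<le> prob (\<Union>i\<in>{1..n}. tail {i} t) + prob (\<Union>k<Suc n. ?E k \<inter> ?T k)"
    using E T D by (intro measure_Un_le) auto
  also have "prob (\<Union>i\<in>{1..n}. tail {i} t) \<le> (\<Sum>i=1..n. prob (tail {i} t))"
    using D by (intro finite_measure_subadditive_finite) auto
  also have "prob (\<Union>k<Suc n. ?E k \<inter> ?T k) \<le> (\<Sum>k<Suc n. prob (?E k \<inter> ?T k))"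
    using E T by (intro finite_measure_subadditive_finite) auto
  also note stopped
  finally show ?thesis by simp
qed

section \<open>Iterating along powers of three\<close>

text \<open>With \<open>d = 3 powr \<delta>\<close>, the bound \<open>8 * C * d * F 1 / d ^ k\<close> for \<open>F (3 ^ k)\<close> reproduces itself: the
  linear term supplies one half of the next bound, and the smallness of \<open>F 1\<close> is exactly what makes
  the quadratic term supply at most the other half. Passing from \<open>3 ^ k\<close> to an arbitrary \<open>t\<close> below
  \<open>3 ^ Suc k\<close> costs another factor \<open>d\<close>, hence \<open>d * d = 9 powr \<delta>\<close>.\<close>

lemma tripling_recursion_decay:
  fixes F :: "real \<Rightarrow> real"
  assumes nonneg: "\<And>t. 0 \<le> F t" and "antimono F"
    and C: "1 \<le> C" and \<delta>: "0 < \<delta>" and small: "64 * C * 9 powr \<delta> * F 1 \<le> 1"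
    and step: "\<And>t. 1 \<le> t \<Longrightarrow> F (3 * t) \<le> 4 * C * t powr (-\<delta>) * F 1 + 4 * (F t)\<^sup>2"
    and t: "1 \<le> t"
  shows "F t \<le> 8 * C * 9 powr \<delta> * t powr (-\<delta>) * F 1"
proof -
  define d where "d = 3 powr \<delta>"
  define p where "p = F 1"
  have d: "1 \<le> d" using \<delta> by (simp add: d_def ge_one_powr_ge_zero)
  have d9: "9 powr \<delta> = d * d"
    using powr_mult[of 3 3 \<delta>] by (simp add: d_def)
  have p0: "0 \<le> p" by (simp add: p_def nonneg)
  have pow: "(3 ^ k) powr (-\<delta>) = 1 / d ^ k" for k
  proof -
    have "(3 ^ k :: real) powr (-\<delta>) = (3 powr (-\<delta>)) ^ k"
      by (induction k) (simp_all add: powr_mult)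
    then show ?thesis by (simp add: d_def powr_minus power_inverse field_simps power_one_over)
  qed
  have geometric: "F (3 ^ k) \<le> 8 * C * d * p / d ^ k" for k
  proof (induction k)
    case 0
    have "1 * 1 \<le> (8 * C) * d" using C d by (intro mult_mono) auto
    then have "1 * p \<le> 8 * C * d * p" using p0 by (intro mult_right_mono) auto
    then show ?case by (simp add: p_def)
  next
    case (Suc k)
    have dk: "1 \<le> d ^ k" using d by simp
    have "(F (3 ^ k))\<^sup>2 \<le> (8 * C * d * p / d ^ k)\<^sup>2"
      using Suc nonneg by (intro power_mono) auto
    also have "\<dots> = (C * p / d ^ k) * (64 * C * (d * d) * p) / d ^ k"
      by (simp add: power2_eq_square)
    also have "\<dots> \<le> (C * p / d ^ k) * 1 / 1"
      using small C p0 d dk by (intro frac_le mult_left_mono mult_nonneg_nonneg) (auto simp: d9 p_def)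
    finally have sq: "(F (3 ^ k))\<^sup>2 \<le> C * p / d ^ k" by simp
    have "F (3 ^ Suc k) \<le> 4 * C * (1 / d ^ k) * p + 4 * (F (3 ^ k))\<^sup>2"
      using step[of "3 ^ k"] by (simp add: pow p_def)
    also have "\<dots> \<le> 8 * (C * p / d ^ k)" using sq by simp
    also have "\<dots> = 8 * C * d * p / d ^ Suc k" using d by simp
    finally show ?case .
  qed
  define k where "k = nat \<lfloor>log 3 t\<rfloor>"
  have log0: "0 \<le> log 3 t" using t by simp
  have "real k \<le> log 3 t" "log 3 t < real (Suc k)"
    unfolding k_def using log0 by linarith+
  then have lower: "3 ^ k \<le> t" and upper: "t \<le> 3 ^ Suc k"
    using t by (auto simp: le_log_iff log_less_iff powr_realpow[symmetric] simp del: power_Suc)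
  have "F t \<le> F (3 ^ k)" using \<open>antimono F\<close> lower by (rule antimonoD)
  also have "\<dots> \<le> 8 * C * d * p / d ^ k" by (rule geometric)
  also have "\<dots> = 8 * C * (d * d) * p * (3 ^ Suc k) powr (-\<delta>)"
    using d unfolding pow by simp
  also have "\<dots> \<le> 8 * C * (d * d) * p * t powr (-\<delta>)"
    using upper t \<delta> C d p0 by (intro mult_left_mono powr_mono2') auto
  finally show ?thesis by (simp add: d9 p_def mult_ac)
qed

section \<open>Sums inherit the weak Borell inequality\<close>

theorem theorem2:
  fixes M :: "'a measure"
    and X :: "nat \<Rightarrow> 'a \<Rightarrow> 'e::{banach, second_countable_topology}"
    and n :: nat
    and C \<delta> \<theta> :: real
  assumes "prob_space M"
    and "1 \<le> C" and "0 < \<delta>" and "0 < \<theta>" and "\<theta> < 1"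
    and "\<And>i. i \<in> {1..n} \<Longrightarrow> symmetric_rv M (X i)"
    and "prob_space.indep_vars M (\<lambda>_. borel) X {1..n}"
    and "\<And>i. i \<in> {1..n} \<Longrightarrow> WB M (X i) C \<delta> \<theta>"
  shows "WB M (\<lambda>\<omega>. \<Sum>i=1..n. X i \<omega>) (12 * 9 powr \<delta> * C) \<delta>
           (min (\<theta> / 2) (inverse (96 * C * 9 powr \<delta>)))"
proof -
  interpret prob_space M by fact
  interpret independent_symmetric M X "{1..n}"
    by unfold_locales (use assms in auto)
  have nine: "1 \<le> 9 powr \<delta>" using \<open>0 < \<delta>\<close> by (simp add: ge_one_powr_ge_zero)
  have C9: "1 \<le> C * 9 powr \<delta>" using mult_mono[of 1 C 1 "9 powr \<delta>"] \<open>1 \<le> C\<close> nine by simp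
  have decay: "\<P>(\<omega> in M. N (\<Sum>i=1..n. X i \<omega>) > t)
      \<le> 12 * 9 powr \<delta> * C * t powr (-\<delta>) * \<P>(\<omega> in M. N (\<Sum>i=1..n. X i \<omega>) > 1)"
    if N: "is_norm N" "continuous_on UNIV N"
      and small: "\<P>(\<omega> in M. N (\<Sum>i=1..n. X i \<omega>) > 1) < min (\<theta> / 2) (inverse (96 * C * 9 powr \<delta>))"
      and t: "1 \<le> t" for N t
  proof -
    interpret normed_independent_symmetric M X "{1..n}" N
      by unfold_locales (use N in auto)
    define F where "F s = prob (tail {1..n} s)" for s
    have F1: "F 1 < \<theta> / 2" "96 * C * 9 powr \<delta> * F 1 < 1"
      using small C9 by (auto simp: F_def field_simps)
    have "1 * F 1 \<le> C * 9 powr \<delta> * F 1"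
      using C9 by (intro mult_right_mono) (auto simp: F_def)
    with F1(2) have quarter: "F 1 \<le> 1 / 4" by simp
    have one: "\<P>(\<omega> in M. N (X i \<omega>) > s) \<le> C * s powr (-\<delta>) * \<P>(\<omega> in M. N (X i \<omega>) > 1)"
      if i: "i \<in> {1..n}" and s: "1 \<le> s" for i s
    proof -
      have "\<P>(\<omega> in M. N (X i \<omega>) > 1) \<le> 2 * F 1"
        using prob_partial_sum_le[of "{i}" 1] i by (simp add: F_def)
      also have "\<dots> < \<theta>" using F1 by simp
      finally show ?thesis using assms(8)[OF i] N s unfolding WB_def by blast
    qed
    have "F t \<le> 8 * C * 9 powr \<delta> * t powr (-\<delta>) * F 1"
    proof (rule tripling_recursion_decay[OF _ _ \<open>1 \<le> C\<close> \<open>0 < \<delta>\<close> _ _ t])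
      show "0 \<le> F s" for s by (simp add: F_def)
      show "antimono F"
        unfolding F_def by (intro antimonoI finite_measure_mono tail_sets) auto
      have "0 \<le> C * 9 powr \<delta> * F 1" using C9 by (simp add: F_def)
      then show "64 * C * 9 powr \<delta> * F 1 \<le> 1" using F1(2) by simp
      show "F (3 * s) \<le> 4 * C * s powr (-\<delta>) * F 1 + 4 * (F s)\<^sup>2" if s: "1 \<le> s" for s
      proof -
        have "(\<Sum>i=1..n. \<P>(\<omega> in M. N (X i \<omega>) > s))
            \<le> (\<Sum>i=1..n. C * s powr (-\<delta>) * \<P>(\<omega> in M. N (X i \<omega>) > 1))"
          using one s by (intro sum_mono) auto
        also have "\<dots> = C * s powr (-\<delta>) * (\<Sum>i=1..n. \<P>(\<omega> in M. N (X i \<omega>) > 1))"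
          by (simp add: sum_distrib_left)
        also have "\<dots> \<le> C * s powr (-\<delta>) * (4 * F 1)"
          using sum_prob_summand_le[of 1] quarter \<open>1 \<le> C\<close>
          by (intro mult_left_mono) (auto simp: F_def)
        finally show ?thesis
          using Hoffmann_Jorgensen[OF normed_independent_symmetric_axioms, of s] s
          by (simp add: F_def)
      qed
    qed
    also have "\<dots> \<le> 12 * (C * 9 powr \<delta> * t powr (-\<delta>) * F 1)"
      using \<open>1 \<le> C\<close> by (simp add: F_def mult_right_mono)
    finally show ?thesis by (simp add: F_def mult_ac)
  qed
  have const: "1 \<le> 12 * 9 powr \<delta> * C" using C9 by (simp add: mult_ac)
  have "0 < inverse (96 * C * 9 powr \<delta>)" using \<open>1 \<le> C\<close> nine by simp
  then show ?thesis
    unfolding WB_def using assms(3-5) const symmetric_sum decay by auto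
qed

end
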